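(* Consider the closed-loop system $x_{t+1}=A(\delta_t)x_t+B(\delta_t)u_t+w(\delta_t)$, $x_0=\bar x_0$, under the SCMPC feedback law $u_t:=u'_{0|t}$ described in the context. Suppose that the assumptions on the uncertainty, on the control problem, and on resolvability (all stated in the context) hold, and let $(K,R)$ be an admissible sample-removal pair for the level $\varepsilon\in(0,0.5)$. Let $M_t:=\mathbf 1_{\mathbb X^{\mathrm C}}(x_{t+1})$, i.e. $M_t=1$ if $x_{t+1}\notin\mathbb X$ and $M_t=0$ otherwise. Then the expected time-average of closed-loop constraint violations remains below the level $\varepsilon$: for every $T\in\mathbb N$ (with $T\ge 1$), $$\mathbf E^{TD}\Bigl[\frac1T\sum_{t=0}^{T-1}M_t\Bigr]\le\varepsilon .$$
   Context: **System.** $x_{t+1}=A(\delta_t)x_t+B(\delta_t)u_t+w(\delta_t)$ with fixed $x_0=\bar x_0\in\mathbb R^n$, where $A(\cdot)\in\mathbb R^{n\times n}$, $B(\cdot)\in\mathbb R^{n\times m}$, $w(\cdot)\in\mathbb R^n$ are known functions of the uncertainty $\delta_t$. Inputs must lie in $\mathbb U\subset\mathbb R^m$; $\mathbb X\subset\mathbb R^n$ is the state constraint set; $\ell:\mathbb R^n\times\mathbb R^m\to[0,\infty)$ is the stage cost; $N\ge1$ is the prediction horizon. **Assumption (uncertainty).** $\delta_0,\delta_1,\dots$ are i.i.d. random variables on a probability space $(\Delta,\mathbf P)$ (each with law $\mathbf P$), and sufficiently many i.i.d. samples of $\delta_t$ can be drawn. Every relevant subset is assumed measurable. **Assumption (control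 problem).** The state $x_t$ is measured at each $t$; $\mathbb U$ is bounded and convex; $\mathbb X$ is convex; $\ell$ is convex. **Scenarios and removal.** At each time $t$, draw i.i.d. samples $\delta^{(k)}_{i|t}\sim\mathbf P$, $i=0,\dots,N-1$, $k=1,\dots,K$, independent over all $t,i,k$ and of $\{\delta_s\}_{s\ge0}$. The $k$-th scenario is $\omega^{(k)}_t:=\{\delta^{(k)}_{0|t},\dots,\delta^{(k)}_{N-1|t}\}$. For $R\ge0$, a removal algorithm is, for each $\xi\in\mathbb R^n$, a deterministic function $\mathcal A_\xi:\Delta^{NK}\to\Delta^{N(K-R)}$ selecting $K-R$ of the $K$ scenarios; at time $t$, $\mathcal A_{x_t}$ is used (for $R=0$ all scenarios are kept). $(K,R)$ is called a sample-removal pair. **Finite-horizon scenario program (FHSCP) at time $t$.** Minimize over $u_{0|t},\dots,u_{N-1|t}$ the cost $\sum_{k=1}^K\sum_{i=0}^{N-1}\ell(x^{(k)}_{i|t},u_{i|t})$, where $x^{(k)}_{0|t}=x_t$ and $x^{(k)}_{i+1|t}=A(\delta^{(k)}_{i|t})x^{(k)}_{i|t}+B(\delta^{(k)}_{i|t})u_{i|t}+w(\delta^{(k)}_{i|t})$, subject to $u_{i|t}\in\mathbb U$ for $i=0,\dots,N-1$ and $x^{(k)}_{i+1|t}\in\mathbb X$ for $i=0,\dots,N-1$ and all selected (non-removed) scenarios $k$. Its optimal solution $\{u'_{0|t},\dots,u'_{N-1|t}\}$ is the scenario solution, a (measurable) function of $x_t$ and the scenarios drawn at time $t$. SCMPC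 law: $u_t:=u'_{0|t}$. **Assumption (resolvability).** Under SCMPC, the FHSCP admits a feasible solution at every time $t$ almost surely. **Probability notation.** $\Omega_t\in\Delta^{KN}$ denotes the scenarios at time $t$. $D:=KN+1$; $\mathcal F_t:=\{\delta_0,\Omega_0,\dots,\delta_t,\Omega_t\}\in\Delta^{(t+1)D}$. $\mathbf P^{j}$ is the $j$-fold product of $\mathbf P$ and $\mathbf E^{j}$ the corresponding expectation. Thus $x_t$ is a function of $\mathcal F_{t-1}$ and $M_t$ of $\mathcal F_t$. **Violation probability.** $V_t|x_t(\Omega_t):=\mathbf P\bigl[A(\delta_t)x_t+B(\delta_t)u'_{0|t}+w(\delta_t)\notin\mathbb X\mid x_t\bigr]$ (probability over $\delta_t$ only, for given $x_t$ and $\Omega_t$). For a fixed $x_t$, $\mathbf E^{KN}[V_t\mid x_t]:=\int_{\Delta^{KN}}V_t|x_t(\Omega_t)\,d\mathbf P^{KN}$. **Support rank $\rho_1$.** The unconstrained subspace of the state constraint on $x_{1|t}$ is the largest linear subspace $\mathcal L\subset\mathbb R^{Nm}$ of the space of decision vectors $(u_{0|t},\dots,u_{N-1|t})$ that is unconstrained by almost every sampled instance of this constraint (i.e. adding any element of $\mathcal L$ to a decision vector does not change whether the sampled constraint is satisfied). The support rank is $\rho_1:=Nm-\dim\mathcal L$. **Admissible pair.** Let $$U_{K,R,\rho_1}(\nu):=\min\Bigl\{1,\binom{R+\rho_1-1}{R}\sum_{j=0}^{R+\rho_1-1}\binom Kj\nu^j(1-\nu)^{K-j}\Bigr\},\quad\nu\in[0,1].$$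 $(K,R)$ is admissible if its substitution into the bound $\mathbf E^{KN}[V_t\mid x_t]\le\int_0^1U_{K,R,\rho_1}(\nu)\,d\nu$ yields $\mathbf E^{KN}[V_t\mid x_t]\le\varepsilon$; that is, $\mathbf E^{KN}[V_t\mid x_t]\le\int_0^1U_{K,R,\rho_1}(\nu)\,d\nu\le\varepsilon$ for every state $x_t\in\mathbb R^n$ at which the FHSCP is almost surely feasible. *)

theory Defs
  imports "HOL-Probability.Probability" "HOL-Library.Function_Algebras"
begin

text \<open>
  Input sequences \<open>(u\<^sub>0, \<dots>, u\<^sub>N\<^sub>-\<^sub>1)\<close> are functions \<open>nat \<Rightarrow> real^'m\<close> that vanish from index \<open>N\<close>
  on.  Pointwise operations turn the function type into a real vector space, so that \<open>subspace\<close>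
  and \<open>dim\<close> apply to sets of such sequences.
\<close>

instantiation "fun" :: (type, real_vector) real_vector
begin

definition scaleR_fun :: "real \<Rightarrow> ('a \<Rightarrow> 'b) \<Rightarrow> 'a \<Rightarrow> 'b"
  where "scaleR_fun r f = (\<lambda>x. r *\<^sub>R f x)"

instance
  by standard (auto simp: scaleR_fun_def fun_eq_iff scaleR_add_right scaleR_add_left)

end

definition decision_vectors :: "nat \<Rightarrow> (nat \<Rightarrow> real^'m) set"
  where "decision_vectors N = {u. \<forall>i\<ge>N. u i = 0}"

lemma scaleR_fun_apply [simp]: "(r *\<^sub>R f) x = r *\<^sub>R f x"
  by (simp add: scaleR_fun_def)

lemma subspace_decision_vectors: "subspace (decision_vectors N)"
  by (auto simp: subspace_def decision_vectors_def)

lemma inj_on_unit_inputs: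
  "inj_on (\<lambda>(i, b). (\<lambda>j. if j = i then b else 0)) ({..<N::nat} \<times> (Basis :: (real^'m) set))"
proof (rule inj_onI)
  fix p q :: "nat \<times> (real^'m)"
  assume pq: "p \<in> {..<N} \<times> Basis" "q \<in> {..<N} \<times> Basis"
    and "(\<lambda>(i, b). (\<lambda>j. if j = i then b else 0)) p = (\<lambda>(i, b). (\<lambda>j. if j = i then b else 0)) q"
  then have eq: "(\<lambda>j. if j = fst p then snd p else 0) = (\<lambda>j. if j = fst q then snd q else 0)"
    by (simp add: case_prod_beta)
  have "snd p \<noteq> 0" using pq(1) nonzero_Basis by auto
  then have "fst p = fst q" using fun_cong[OF eq, of "fst p"] by (auto split: if_splits)
  then show "p = q" using fun_cong[OF eq, of "fst p"] by (simp add: prod_eq_iff)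
qed

lemma independent_unit_inputs:
  "independent ((\<lambda>(i, b). (\<lambda>j. if j = i then b else 0)) ` ({..<N::nat} \<times> (Basis :: (real^'m) set)))"
    (is "independent (?e ` ?I)")
proof -
  have inj: "inj_on ?e ?I" by (rule inj_on_unit_inputs)
  have fin: "finite ?I" by simp
  show ?thesis
  proof (subst independent_explicit_finite_subsets, intro allI impI ballI)
    fix S c v
    assume S: "S \<subseteq> ?e ` ?I" "finite S" and s0: "(\<Sum>v\<in>S. c v *\<^sub>R v) = 0" and v: "v \<in> S"
    obtain J where J: "J \<subseteq> ?I" "S = ?e ` J"
      using S(1) by (meson subset_imageE)
    have injJ: "inj_on ?e J" using inj J(1) inj_on_subset by blast
    have finJ: "finite J" using J(1) fin finite_subset by blast
    obtain i b where ib: "(i, b) \<in> J" "v = ?e (i, b)" using v J(2) by auto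
    have bB: "b \<in> Basis" using ib J(1) by auto
    have "(\<Sum>p\<in>J. c (?e p) *\<^sub>R ?e p) = 0"
      using s0 J(2) by (simp add: sum.reindex[OF injJ])
    moreover have "(\<Sum>p\<in>J. c (?e p) *\<^sub>R ?e p) i = (\<Sum>p\<in>J. c (?e p) *\<^sub>R ?e p i)"
      using finJ by (induction J rule: finite_induct) auto
    ultimately have "(\<Sum>p\<in>J. c (?e p) *\<^sub>R ?e p i) = 0" by simp
    then have "0 = (\<Sum>p\<in>J. c (?e p) *\<^sub>R ?e p i) \<bullet> b" by simp
    also have "\<dots> = (\<Sum>p\<in>J. c (?e p) * (?e p i \<bullet> b))"
      by (simp add: inner_sum_left)
    also have "\<dots> = (\<Sum>p\<in>J. if p = (i, b) then c v else 0)"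
    proof (rule sum.cong[OF refl])
      fix p assume "p \<in> J"
      obtain k d where p: "p = (k, d)" by force
      have "d \<in> Basis" using \<open>p \<in> J\<close> J(1) p by auto
      then show "c (?e p) * (?e p i \<bullet> b) = (if p = (i, b) then c v else 0)"
        using bB ib(2) p by (auto simp: inner_Basis)
    qed
    also have "\<dots> = c v" using ib(1) finJ by simp
    finally show "c v = 0" by simp
  qed
qed

lemma decision_vectors_span:
  "decision_vectors N =
    span ((\<lambda>(i, b). (\<lambda>j. if j = i then b else 0)) ` ({..<N} \<times> (Basis :: (real^'m) set)))"
    (is "_ = span (?e ` ?I)")
proof
  show "span (?e ` ?I) \<subseteq> decision_vectors N"
    by (intro span_minimal subspace_decision_vectors) (auto simp: decision_vectors_def)
  show "decision_vectors N \<subseteq> span (?e ` ?I)"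
  proof
    fix u :: "nat \<Rightarrow> real^'m" assume u: "u \<in> decision_vectors N"
    have "u = (\<Sum>p\<in>?I. (u (fst p) \<bullet> snd p) *\<^sub>R ?e p)"
    proof
      fix j
      have app: "(\<Sum>p\<in>J. (u (fst p) \<bullet> snd p) *\<^sub>R ?e p) j = (\<Sum>p\<in>J. (u (fst p) \<bullet> snd p) *\<^sub>R ?e p j)"
        if "finite J" for J using that by (induction J rule: finite_induct) auto
      have "(\<Sum>p\<in>?I. (u (fst p) \<bullet> snd p) *\<^sub>R ?e p j)
          = (\<Sum>i<N. \<Sum>b\<in>Basis. (u i \<bullet> b) *\<^sub>R (if j = i then b else 0))"
        by (subst sum.cartesian_product) (auto intro!: sum.cong)
      also have "\<dots> = (\<Sum>i<N. if i = j then u i else 0)"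
        by (intro sum.cong) (auto simp: euclidean_representation)
      also have "\<dots> = u j" using u by (auto simp: decision_vectors_def not_less)
      finally show "u j = (\<Sum>p\<in>?I. (u (fst p) \<bullet> snd p) *\<^sub>R ?e p) j" using app[of ?I] by simp
    qed
    moreover have "(\<Sum>p\<in>?I. (u (fst p) \<bullet> snd p) *\<^sub>R ?e p) \<in> span (?e ` ?I)"
      by (intro span_sum span_scale span_base) auto
    ultimately show "u \<in> span (?e ` ?I)" by simp
  qed
qed

lemma dim_decision_vectors: "dim (decision_vectors N :: (nat \<Rightarrow> real^'m) set) = N * CARD('m)"
  unfolding decision_vectors_span
  by (simp only: dim_span dim_eq_card_independent[OF independent_unit_inputs]
      card_image[OF inj_on_unit_inputs]) simp


section \<open>Dynamics and the finite-horizon scenario program\<close>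

definition succ_state ::
  "('d \<Rightarrow> real^'n^'n) \<Rightarrow> ('d \<Rightarrow> real^'m^'n) \<Rightarrow> ('d \<Rightarrow> real^'n) \<Rightarrow> 'd \<Rightarrow> real^'n \<Rightarrow> real^'m \<Rightarrow> real^'n"
  where "succ_state A B w d x u = A d *v x + B d *v u + w d"

primrec pred_state ::
  "('d \<Rightarrow> real^'n^'n) \<Rightarrow> ('d \<Rightarrow> real^'m^'n) \<Rightarrow> ('d \<Rightarrow> real^'n) \<Rightarrow> real^'n \<Rightarrow> (nat \<Rightarrow> 'd) \<Rightarrow>
   (nat \<Rightarrow> real^'m) \<Rightarrow> nat \<Rightarrow> real^'n"
  where
    "pred_state A B w x ds u 0 = x"
  | "pred_state A B w x ds u (Suc i) = succ_state A B w (ds i) (pred_state A B w x ds u i) (u i)"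

text \<open>
  The \<open>K\<close> scenarios of one time step form a single function \<open>om\<close> on index pairs:
  \<open>om (i, k)\<close> is the sample for prediction step \<open>i < N\<close> in scenario \<open>k \<in> {1..K}\<close>.
\<close>

definition fhscp_cost ::
  "('d \<Rightarrow> real^'n^'n) \<Rightarrow> ('d \<Rightarrow> real^'m^'n) \<Rightarrow> ('d \<Rightarrow> real^'n) \<Rightarrow> (real^'n \<Rightarrow> real^'m \<Rightarrow> real) \<Rightarrow>
   nat \<Rightarrow> nat \<Rightarrow> real^'n \<Rightarrow> (nat \<times> nat \<Rightarrow> 'd) \<Rightarrow> (nat \<Rightarrow> real^'m) \<Rightarrow> real"
  where "fhscp_cost A B w l N K x om u =
    (\<Sum>k = 1..K. \<Sum>i<N. l (pred_state A B w x (\<lambda>j. om (j, k)) u i) (u i))"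

text \<open>
  The removal algorithm is given by the indices it keeps: \<open>sel x om\<close> is the set of the
  non-removed scenarios.
\<close>

definition fhscp_feasible ::
  "('d \<Rightarrow> real^'n^'n) \<Rightarrow> ('d \<Rightarrow> real^'m^'n) \<Rightarrow> ('d \<Rightarrow> real^'n) \<Rightarrow> (real^'m) set \<Rightarrow> (real^'n) set \<Rightarrow> nat \<Rightarrow>
   (real^'n \<Rightarrow> (nat \<times> nat \<Rightarrow> 'd) \<Rightarrow> nat set) \<Rightarrow> real^'n \<Rightarrow> (nat \<times> nat \<Rightarrow> 'd) \<Rightarrow> (nat \<Rightarrow> real^'m) set"
  where "fhscp_feasible A B w U X N sel x om =
    {u \<in> decision_vectors N.
       (\<forall>i<N. u i \<in> U) \<and>
       (\<forall>k\<in>sel x om. \<forall>i<N. pred_state A B w x (\<lambda>j. om (j, k)) u (Suc i) \<in> X)}"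

definition fhscp_solutions ::
  "('d \<Rightarrow> real^'n^'n) \<Rightarrow> ('d \<Rightarrow> real^'m^'n) \<Rightarrow> ('d \<Rightarrow> real^'n) \<Rightarrow> (real^'n \<Rightarrow> real^'m \<Rightarrow> real) \<Rightarrow>
   (real^'m) set \<Rightarrow> (real^'n) set \<Rightarrow> nat \<Rightarrow> nat \<Rightarrow>
   (real^'n \<Rightarrow> (nat \<times> nat \<Rightarrow> 'd) \<Rightarrow> nat set) \<Rightarrow> real^'n \<Rightarrow> (nat \<times> nat \<Rightarrow> 'd) \<Rightarrow> (nat \<Rightarrow> real^'m) set"
  where "fhscp_solutions A B w l U X N K sel x om =
    {u \<in> fhscp_feasible A B w U X N sel x om.
       \<forall>v\<in>fhscp_feasible A B w U X N sel x om.
         fhscp_cost A B w l N K x om u \<le> fhscp_cost A B w l N K x om v}"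


section \<open>Probability spaces and the closed loop\<close>

definition scenario_law :: "'d measure \<Rightarrow> nat \<Rightarrow> nat \<Rightarrow> (nat \<times> nat \<Rightarrow> 'd) measure"
  where "scenario_law P N K = Pi\<^sub>M ({..<N} \<times> {1..K}) (\<lambda>_. P)"

text \<open>
  \<open>history_law P N K T\<close> is the law of \<open>(\<delta>\<^sub>0, \<Omega>\<^sub>0), \<dots>, (\<delta>\<^sub>T\<^sub>-\<^sub>1, \<Omega>\<^sub>T\<^sub>-\<^sub>1)\<close>, the product of
  \<open>T * (K * N + 1)\<close> copies of \<open>P\<close>, grouped by time step.
\<close>

definition history_law ::
  "'d measure \<Rightarrow> nat \<Rightarrow> nat \<Rightarrow> nat \<Rightarrow> (nat \<Rightarrow> 'd \<times> (nat \<times> nat \<Rightarrow> 'd)) measure"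
  where "history_law P N K T = Pi\<^sub>M {..<T} (\<lambda>_. P \<Otimes>\<^sub>M scenario_law P N K)"

primrec closed_loop ::
  "('d \<Rightarrow> real^'n^'n) \<Rightarrow> ('d \<Rightarrow> real^'m^'n) \<Rightarrow> ('d \<Rightarrow> real^'n) \<Rightarrow>
   (real^'n \<Rightarrow> (nat \<times> nat \<Rightarrow> 'd) \<Rightarrow> nat \<Rightarrow> real^'m) \<Rightarrow> real^'n \<Rightarrow>
   (nat \<Rightarrow> 'd \<times> (nat \<times> nat \<Rightarrow> 'd)) \<Rightarrow> nat \<Rightarrow> real^'n"
  where
    "closed_loop A B w sol x0 F 0 = x0"
  | "closed_loop A B w sol x0 F (Suc t) =
       succ_state A B w (fst (F t)) (closed_loop A B w sol x0 F t)
         (sol (closed_loop A B w sol x0 F t) (snd (F t)) 0)"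

definition violation_prob ::
  "'d measure \<Rightarrow> ('d \<Rightarrow> real^'n^'n) \<Rightarrow> ('d \<Rightarrow> real^'m^'n) \<Rightarrow> ('d \<Rightarrow> real^'n) \<Rightarrow> (real^'n) set \<Rightarrow>
   (real^'n \<Rightarrow> (nat \<times> nat \<Rightarrow> 'd) \<Rightarrow> nat \<Rightarrow> real^'m) \<Rightarrow> real^'n \<Rightarrow> (nat \<times> nat \<Rightarrow> 'd) \<Rightarrow> real"
  where "violation_prob P A B w X sol x om =
    measure P {d \<in> space P. succ_state A B w d x (sol x om 0) \<notin> X}"


section \<open>Support rank and admissible sample-removal pairs\<close>

text \<open>
  The constraint is the one on the first predicted state, \<open>A(\<delta>) x + B(\<delta>) u\<^sub>0 + w(\<delta>) \<in> X\<close>, whose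
  instances depend on the measured state \<open>x\<close>; the support rank is therefore a function of \<open>x\<close>.
\<close>

definition unconstrained ::
  "'d measure \<Rightarrow> ('d \<Rightarrow> real^'n^'n) \<Rightarrow> ('d \<Rightarrow> real^'m^'n) \<Rightarrow> ('d \<Rightarrow> real^'n) \<Rightarrow> (real^'n) set \<Rightarrow> nat \<Rightarrow>
   real^'n \<Rightarrow> (nat \<Rightarrow> real^'m) set \<Rightarrow> bool"
  where "unconstrained P A B w X N x L \<longleftrightarrow>
    subspace L \<and> L \<subseteq> decision_vectors N \<and>
    (AE d in P. \<forall>v\<in>L. \<forall>u\<in>decision_vectors N.
       succ_state A B w d x ((u + v) 0) \<in> X \<longleftrightarrow> succ_state A B w d x (u 0) \<in> X)"

definition unconstrained_subspace ::
  "'d measure \<Rightarrow> ('d \<Rightarrow> real^'n^'n) \<Rightarrow> ('d \<Rightarrow> real^'m^'n) \<Rightarrow> ('d \<Rightarrow> real^'n) \<Rightarrow> (real^'n) set \<Rightarrow> nat \<Rightarrow>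
   real^'n \<Rightarrow> (nat \<Rightarrow> real^'m) set"
  where "unconstrained_subspace P A B w X N x = (GREATEST L. unconstrained P A B w X N x L)"

text \<open>The greatest such subspace exists, so the description above is meaningful.\<close>

lemma unconstrained_subspace_greatest:
  fixes B :: "'d \<Rightarrow> real^'m^'n"
  shows "unconstrained P A B w X N x (unconstrained_subspace P A B w X N x)"
    and "unconstrained P A B w X N x L \<Longrightarrow> L \<subseteq> unconstrained_subspace P A B w X N x"
proof -
  let ?Q = "unconstrained P A B w X N x"
  note Q_def = unconstrained_def
  define E where "E = (\<lambda>(i, b). (\<lambda>j. if j = i then b else 0)) ` ({..<N} \<times> (Basis :: (real^'m) set))"
  have finE: "finite E" and dvE: "decision_vectors N = span E"
    by (simp_all add: E_def decision_vectors_span)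
  define C where "C = {card b |b. independent b \<and> ?Q (span b)}"
  have bound: "finite b \<and> card b \<le> card E" if "independent b" "?Q (span b)" for b
    using that dvE independent_span_bound[OF finE that(1)] span_superset[of b]
    unfolding Q_def by blast
  have "finite C"
    using bound by (intro finite_subset[of C "{..card E}"]) (auto simp: C_def)
  have "?Q (span {})"
    by (simp add: Q_def) (simp add: decision_vectors_def)
  then have "card ({} :: (nat \<Rightarrow> real^'m) set) \<in> C" unfolding C_def using independent_empty by blast
  then have "Max C \<in> C" using \<open>finite C\<close> by (intro Max_in) auto
  then obtain b where b: "independent b" "?Q (span b)" "card b = Max C" unfolding C_def by force
  have finb: "finite b" using bound b by blast
  have max: "M \<subseteq> span b" if M: "?Q M" for M
  proof
    fix v assume v: "v \<in> M"
    show "v \<in> span b"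
    proof (rule ccontr)
      assume nv: "v \<notin> span b"
      have ind: "independent (insert v b)" using b(1) nv by (simp add: independent_insertI)
      have vb: "\<exists>k y. z = y + k *\<^sub>R v \<and> y \<in> span b" if "z \<in> span (insert v b)" for z
        using that unfolding span_breakdown_eq by (metis diff_add_cancel)
      have "?Q (span (insert v b))"
        unfolding Q_def
      proof (intro conjI)
        show "span (insert v b) \<subseteq> decision_vectors N"
          using b(2) M v span_superset[of b]
          by (intro span_minimal subspace_decision_vectors) (auto simp: Q_def)
        have "AE d in P. \<forall>v\<in>span b. \<forall>u\<in>decision_vectors N.
            succ_state A B w d x ((u + v) 0) \<in> X \<longleftrightarrow> succ_state A B w d x (u 0) \<in> X"
          "AE d in P. \<forall>v\<in>M. \<forall>u\<in>decision_vectors N.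
            succ_state A B w d x ((u + v) 0) \<in> X \<longleftrightarrow> succ_state A B w d x (u 0) \<in> X"
          using b(2) M by (auto simp: Q_def)
        then show "AE d in P. \<forall>v\<in>span (insert v b). \<forall>u\<in>decision_vectors N.
            succ_state A B w d x ((u + v) 0) \<in> X \<longleftrightarrow> succ_state A B w d x (u 0) \<in> X"
        proof eventually_elim
          case (elim d)
          show ?case
          proof (intro ballI)
            fix z u :: "nat \<Rightarrow> real^'m" assume z: "z \<in> span (insert v b)" and u: "u \<in> decision_vectors N"
            obtain k y where y: "z = y + k *\<^sub>R v" "y \<in> span b" using vb[OF z] by blast
            have "k *\<^sub>R v \<in> M" using M v by (auto simp: Q_def subspace_scale)
            moreover have "u + y \<in> decision_vectors N"
              using u y b(2) by (auto simp: Q_def intro: subspace_add[OF subspace_decision_vectors])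
            moreover have "u + z = (u + y) + k *\<^sub>R v" by (simp add: y(1) add.assoc)
            ultimately show "succ_state A B w d x ((u + z) 0) \<in> X \<longleftrightarrow> succ_state A B w d x (u 0) \<in> X"
              using elim u y(2) by metis
          qed
        qed
      qed (rule subspace_span)
      then have "card (insert v b) \<in> C" unfolding C_def using ind by blast
      then have "card (insert v b) \<le> card b" using b(3) \<open>finite C\<close> by simp
      moreover have "v \<notin> b" using nv span_superset by blast
      ultimately show False using finb by simp
    qed
  qed
  have eq: "unconstrained_subspace P A B w X N x = span b"
    unfolding unconstrained_subspace_def
    by (rule Greatest_equality) (use b(2) max in \<open>auto simp: Q_def\<close>)
  show "?Q (unconstrained_subspace P A B w X N x)" using b(2) eq by simp
  show "?Q L \<Longrightarrow> L \<subseteq> unconstrained_subspace P A B w X N x" using max eq by simp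
qed

definition support_rank ::
  "'d measure \<Rightarrow> ('d \<Rightarrow> real^'n^'n) \<Rightarrow> ('d \<Rightarrow> real^'m^'n) \<Rightarrow> ('d \<Rightarrow> real^'n) \<Rightarrow> (real^'n) set \<Rightarrow> nat \<Rightarrow>
   real^'n \<Rightarrow> nat"
  where "support_rank P A B w X N x =
    N * CARD('m) - dim (unconstrained_subspace P A B w X N x :: (nat \<Rightarrow> real^'m) set)"

text \<open>
  Summing over \<open>j < R + \<rho>\<close> instead of \<open>j \<le> R + \<rho> - 1\<close> keeps the sum empty for \<open>R = \<rho> = 0\<close>, where
  subtraction on naturals truncates.
\<close>

definition violation_bound :: "nat \<Rightarrow> nat \<Rightarrow> nat \<Rightarrow> real \<Rightarrow> real"
  where "violation_bound K R \<rho> \<nu> =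
    min 1 (real ((R + \<rho> - 1) choose R) *
           (\<Sum>j<R + \<rho>. real (K choose j) * \<nu> ^ j * (1 - \<nu>) ^ (K - j)))"

definition admissible_pair ::
  "'d measure \<Rightarrow> ('d \<Rightarrow> real^'n^'n) \<Rightarrow> ('d \<Rightarrow> real^'m^'n) \<Rightarrow> ('d \<Rightarrow> real^'n) \<Rightarrow> (real^'m) set \<Rightarrow>
   (real^'n) set \<Rightarrow> nat \<Rightarrow> (real^'n \<Rightarrow> (nat \<times> nat \<Rightarrow> 'd) \<Rightarrow> nat set) \<Rightarrow>
   (real^'n \<Rightarrow> (nat \<times> nat \<Rightarrow> 'd) \<Rightarrow> nat \<Rightarrow> real^'m) \<Rightarrow> real \<Rightarrow> nat \<Rightarrow> nat \<Rightarrow> bool"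
  where "admissible_pair P A B w U X N sel sol \<epsilon> K R \<longleftrightarrow>
    (\<forall>x. (AE om in scenario_law P N K. fhscp_feasible A B w U X N sel x om \<noteq> {}) \<longrightarrow>
       (LINT om|scenario_law P N K. violation_prob P A B w X sol x om)
         \<le> integral {0..1} (violation_bound K R (support_rank P A B w X N x)) \<and>
       integral {0..1} (violation_bound K R (support_rank P A B w X N x)) \<le> \<epsilon>)"

end

theory Submission
  imports Defs
begin

text \<open>
  The state \<open>x\<^sub>t\<close> depends only on the first \<open>t\<close> coordinates of the history, so it is independent of
  \<open>(\<delta>\<^sub>t, \<Omega>\<^sub>t)\<close>.  Integrating out \<open>\<delta>\<^sub>t\<close> first turns \<open>M\<^sub>t\<close> into the violation probability \<open>V\<^sub>t\<close>,
  integrating out \<open>\<Omega>\<^sub>t\<close> next gives \<open>E[V\<^sub>t | x\<^sub>t]\<close>.  By resolvability and Fubini the FHSCP is almost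
  surely feasible at almost every reachable \<open>x\<^sub>t\<close>, so admissibility bounds that by \<open>\<epsilon>\<close>.
\<close>

text \<open>Each coordinate is a polynomial in the entries of both arguments. Joint continuity is
  what turns measurability of \<open>A\<close> and of a state into measurability of their
  product.\<close>

lemma continuous_matrix_vector_mult:
  "continuous_on UNIV (\<lambda>p :: (real^'m^'n) \<times> (real^'m). fst p *v snd p)"
  unfolding matrix_vector_mult_def by (intro continuous_intros)

lemma measurable_succ_state:
  fixes A :: "'d \<Rightarrow> real^'n^'n" and B :: "'d \<Rightarrow> real^'m^'n"
  assumes [measurable]: "A \<in> borel_measurable P" "B \<in> borel_measurable P" "w \<in> borel_measurable P"
    and [measurable]: "d \<in> measurable M P" "x \<in> borel_measurable M" "u \<in> borel_measurable M"
  shows "(\<lambda>z. succ_state A B w (d z) (x z) (u z)) \<in> borel_measurable M"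
proof -
  have "(\<lambda>z. A (d z) *v x z) \<in> borel_measurable M"
    by (rule borel_measurable_continuous_Pair[OF _ _ continuous_matrix_vector_mult]) measurable
  moreover have "(\<lambda>z. B (d z) *v u z) \<in> borel_measurable M"
    by (rule borel_measurable_continuous_Pair[OF _ _ continuous_matrix_vector_mult]) measurable
  ultimately show ?thesis
    unfolding succ_state_def by measurable
qed

lemma measurable_closed_loop:
  fixes A :: "'d \<Rightarrow> real^'n^'n" and B :: "'d \<Rightarrow> real^'m^'n"
  assumes [measurable]: "A \<in> borel_measurable P" "B \<in> borel_measurable P" "w \<in> borel_measurable P"
    and sol: "(\<lambda>(x, om). sol x om 0) \<in> borel_measurable (borel \<Otimes>\<^sub>M scenario_law P N K)"
    and "t \<le> T"
  shows "(\<lambda>F. closed_loop A B w sol x0 F t) \<in> borel_measurable (history_law P N K T)"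
  using \<open>t \<le> T\<close>
proof (induction t)
  case (Suc t)
  have [measurable]: "(\<lambda>F. F t) \<in> measurable (history_law P N K T) (P \<Otimes>\<^sub>M scenario_law P N K)"
    using Suc.prems unfolding history_law_def by (intro measurable_component_singleton) simp
  have [measurable]: "(\<lambda>F. closed_loop A B w sol x0 F t) \<in> borel_measurable (history_law P N K T)"
    using Suc by simp
  \<comment> \<open>State and scenarios are both random here, so the control is measurable by joint
    measurability of \<open>sol\<close>; measurability for each fixed state would not
    suffice.\<close>
  have "(\<lambda>F. (\<lambda>(x, om). sol x om 0) (closed_loop A B w sol x0 F t, snd (F t)))
      \<in> borel_measurable (history_law P N K T)"
    by (rule measurable_compose[OF _ sol]) measurable
  then show ?case
    by (auto intro!: measurable_succ_state[of A P B w])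
qed simp

text \<open>Causality of the loop. It allows coordinate \<open>t\<close> to be overwritten without
  changing the state at time \<open>t\<close>, and later coordinates to be dropped.\<close>

lemma closed_loop_cong:
  assumes "\<And>s. s < t \<Longrightarrow> F s = G s"
  shows "closed_loop A B w sol x0 F t = closed_loop A B w sol x0 G t"
  using assms by (induction t) simp_all

lemma prob_space_scenario_law: "prob_space P \<Longrightarrow> prob_space (scenario_law P N K)"
  unfolding scenario_law_def by (intro prob_space_PiM)

lemma prob_space_step_law: "prob_space P \<Longrightarrow> prob_space (P \<Otimes>\<^sub>M scenario_law P N K)"
  by (intro prob_space_pair prob_space_scenario_law)

lemma prob_space_history_law: "prob_space P \<Longrightarrow> prob_space (history_law P N K T)"
  unfolding history_law_def by (intro prob_space_PiM prob_space_step_law)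

text \<open>Marginals of a product of probability measures are the shorter products. This lets a
  term at time \<open>t\<close> be evaluated on horizon \<open>t + 1\<close>, where coordinate
  \<open>t\<close> is the last one.\<close>

lemma history_law_restrict:
  assumes "prob_space P" "t \<le> T"
  shows "history_law P N K t = distr (history_law P N K T) (history_law P N K t) (\<lambda>F. restrict F {..<t})"
proof -
  interpret M: prob_space "P \<Otimes>\<^sub>M scenario_law P N K" using assms(1) by (rule prob_space_step_law)
  interpret product_prob_space "\<lambda>_::nat. P \<Otimes>\<^sub>M scenario_law P N K" by unfold_locales
  show ?thesis
    unfolding history_law_def using assms(2) by (intro distr_restrict) auto
qed

text \<open>The feasible set need not be measurable, so only this direction of Fubini for null sets is available.\<close>

lemma AE_history_law_Suc:
  assumes "prob_space P" "AE F in history_law P N K (Suc t). Q F"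
  shows "AE F in history_law P N K t. AE p in P \<Otimes>\<^sub>M scenario_law P N K. Q (F(t := p))"
proof -
  let ?M = "P \<Otimes>\<^sub>M scenario_law P N K" and ?H = "history_law P N K t"
  interpret M: prob_space ?M using assms(1) by (rule prob_space_step_law)
  interpret H: prob_space ?H using assms(1) by (rule prob_space_history_law)
  interpret HM: pair_sigma_finite ?H ?M by unfold_locales
  interpret MH: pair_sigma_finite ?M ?H by unfold_locales
  interpret product_prob_space "\<lambda>_::nat. ?M" by unfold_locales
  \<comment> \<open>Here the new coordinate is the first factor, whereas the claim has the history
    outermost; hence the swap of factors before Fubini.\<close>
  have eq: "distr (?M \<Otimes>\<^sub>M ?H) (history_law P N K (Suc t)) (\<lambda>(p, F). F(t := p)) = history_law P N K (Suc t)"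
    unfolding history_law_def lessThan_Suc by (rule distr_pair_PiM_eq_PiM) (simp_all add: M.prob_space_axioms)
  have m: "(\<lambda>(p, F). F(t := p)) \<in> measurable (?M \<Otimes>\<^sub>M ?H) (history_law P N K (Suc t))"
    unfolding history_law_def lessThan_Suc by measurable
  have "AE z in ?M \<Otimes>\<^sub>M ?H. Q (case z of (p, F) \<Rightarrow> F(t := p))"
    using assms(2) by (intro AE_distrD[OF m]) (simp only: eq)
  then have "AE z in distr (?H \<Otimes>\<^sub>M ?M) (?M \<Otimes>\<^sub>M ?H) (\<lambda>(x, y). (y, x)). Q (case z of (p, F) \<Rightarrow> F(t := p))"
    unfolding MH.distr_pair_swap[symmetric] .
  from AE_distrD[OF measurable_pair_swap' this] HM.AE_pair
  show ?thesis by fastforce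
qed

text \<open>After Fubini the inner statement no longer mentions the outer variable, and an
  almost-everywhere quantifier over a probability measure is trivial on constants.\<close>

lemma AE_scenario_law_snd:
  assumes "prob_space P" "AE p in P \<Otimes>\<^sub>M scenario_law P N K. Q (snd p)"
  shows "AE om in scenario_law P N K. Q om"
proof -
  interpret P: prob_space P by fact
  interpret S: prob_space "scenario_law P N K" using assms(1) by (rule prob_space_scenario_law)
  interpret PS: pair_sigma_finite P "scenario_law P N K" by unfold_locales
  show ?thesis using PS.AE_pair[OF assms(2)] by simp
qed

text \<open>Fubini with the disturbance innermost: for fixed scenarios the input is fixed, and the
  indicator integrates to the measure of the violating disturbances.\<close>

lemma integral_step_violation:
  fixes A :: "'d \<Rightarrow> real^'n^'n" and B :: "'d \<Rightarrow> real^'m^'n"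
  assumes "prob_space P"
    and [measurable]: "A \<in> borel_measurable P" "B \<in> borel_measurable P" "w \<in> borel_measurable P"
      "X \<in> sets borel"
    and sol: "(\<lambda>(x, om). sol x om 0) \<in> borel_measurable (borel \<Otimes>\<^sub>M scenario_law P N K)"
  shows "(LINT p|(P \<Otimes>\<^sub>M scenario_law P N K). indicat_real (- X) (succ_state A B w (fst p) x (sol x (snd p) 0)))
    = (LINT om|scenario_law P N K. violation_prob P A B w X sol x om)"
proof -
  let ?S = "scenario_law P N K"
  let ?f = "\<lambda>d om. indicat_real (- X) (succ_state A B w d x (sol x om 0))"
  interpret P: prob_space P by fact
  interpret S: prob_space ?S using assms(1) by (rule prob_space_scenario_law)
  interpret PS: pair_prob_space P ?S by unfold_locales
  have solx [measurable]: "(\<lambda>om. sol x om 0) \<in> borel_measurable ?S"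
    using measurable_Pair2[OF sol, of x] by simp
  have "(\<lambda>z. succ_state A B w (fst z) x (sol x (snd z) 0)) \<in> borel_measurable (P \<Otimes>\<^sub>M ?S)"
    by (rule measurable_succ_state[of A P B w]) measurable
  then have "(\<lambda>z. ?f (fst z) (snd z)) \<in> borel_measurable (P \<Otimes>\<^sub>M ?S)"
    by measurable
  then have "integrable (P \<Otimes>\<^sub>M ?S) (\<lambda>(d, om). ?f d om)"
    by (intro PS.integrable_const_bound[where B = 1]) (auto simp: case_prod_beta')
  then have "(LINT p|(P \<Otimes>\<^sub>M ?S). ?f (fst p) (snd p)) = (LINT om|?S. LINT d|P. ?f d om)"
    using PS.integral_snd[of ?f] by (simp add: case_prod_beta')
  also have "\<dots> = (LINT om|?S. violation_prob P A B w X sol x om)"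
  proof (intro Bochner_Integration.integral_cong refl)
    fix om
    have "(LINT d|P. ?f d om) = (LINT d|P. indicat_real {d \<in> space P. succ_state A B w d x (sol x om 0) \<notin> X} d)"
      by (intro Bochner_Integration.integral_cong refl) (simp add: indicator_def)
    then show "(LINT d|P. ?f d om) = violation_prob P A B w X sol x om"
      by (simp add: violation_prob_def Int_def conj_commute cong: conj_cong)
  qed
  finally show ?thesis .
qed

lemma expected_violation_le:
  fixes A :: "'d \<Rightarrow> real^'n^'n" and B :: "'d \<Rightarrow> real^'m^'n"
  assumes prob: "prob_space P"
    and AB [measurable]: "A \<in> borel_measurable P" "B \<in> borel_measurable P" "w \<in> borel_measurable P"
      "X \<in> sets borel"
    and sol: "(\<lambda>(x, om). sol x om 0) \<in> borel_measurable (borel \<Otimes>\<^sub>M scenario_law P N K)"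
    and feas: "AE F in history_law P N K (Suc t).
           fhscp_feasible A B w U X N sel (closed_loop A B w sol x0 F t) (snd (F t)) \<noteq> {}"
    and "0 \<le> \<epsilon>"
    and adm: "admissible_pair P A B w U X N sel sol \<epsilon> K R"
  shows "(LINT F|history_law P N K (Suc t). indicat_real (- X) (closed_loop A B w sol x0 F (Suc t))) \<le> \<epsilon>"
proof -
  let ?M = "P \<Otimes>\<^sub>M scenario_law P N K"
  let ?x = "\<lambda>F. closed_loop A B w sol x0 F t"
  let ?V = "\<lambda>x. LINT om|scenario_law P N K. violation_prob P A B w X sol x om"
  interpret M: prob_space ?M using prob by (rule prob_space_step_law)
  interpret H: prob_space "history_law P N K t" using prob by (rule prob_space_history_law)
  interpret H': prob_space "history_law P N K (Suc t)" using prob by (rule prob_space_history_law)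
  interpret product_prob_space "\<lambda>_::nat. ?M" by unfold_locales
  have past: "?x (F(t := p)) = ?x F" for F p
    by (rule closed_loop_cong) simp
  have [measurable]: "(\<lambda>F. closed_loop A B w sol x0 F (Suc t)) \<in> borel_measurable (history_law P N K (Suc t))"
    by (rule measurable_closed_loop[where sol = sol, OF AB(1-3) sol order_refl])
  have "integrable (history_law P N K (Suc t)) (\<lambda>F. indicat_real (- X) (closed_loop A B w sol x0 F (Suc t)))"
    by (intro H'.integrable_const_bound[where B = 1]) (auto simp del: closed_loop.simps)
  \<comment> \<open>Coordinate \<open>t\<close> is split off as \<open>p\<close>, independent of the
    past \<open>F\<close>; by \<open>past\<close>, the state at time \<open>t\<close> is then a
    constant for the inner integral.\<close>
  then have "(LINT F|history_law P N K (Suc t). indicat_real (- X) (closed_loop A B w sol x0 F (Suc t)))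
    = (LINT F|history_law P N K t. LINT p|?M. indicat_real (- X) (closed_loop A B w sol x0 (F(t := p)) (Suc t)))"
    unfolding history_law_def lessThan_Suc by (intro product_integral_insert) simp_all
  also have "\<dots> = (LINT F|history_law P N K t. ?V (?x F))"
    by (simp add: past integral_step_violation[where sol = sol, OF prob AB sol])
  also have "\<dots> \<le> \<epsilon>"
  proof (cases "integrable (history_law P N K t) (\<lambda>F. ?V (?x F))")
    case True
    have "AE F in history_law P N K t. ?V (?x F) \<le> \<epsilon>"
      using AE_history_law_Suc[OF prob feas]
    proof eventually_elim
      case (elim F)
      \<comment> \<open>With \<open>F\<close> fixed, feasibility involves only the scenario part of
        \<open>p\<close>. This is the premise of admissibility at the single state
        \<open>?x F\<close>.\<close>
      then have "AE om in scenario_law P N K. fhscp_feasible A B w U X N sel (?x F) om \<noteq> {}"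
        by (intro AE_scenario_law_snd[OF prob]) (simp add: past)
      then show ?case using adm unfolding admissible_pair_def by force
    qed
    with True show ?thesis by (rule H.integral_le_const)
    \<comment> \<open>A non-integrable function has integral \<open>0\<close>, so measurability in the state is not required.\<close>
  qed (use \<open>0 \<le> \<epsilon>\<close> in \<open>simp add: not_integrable_integral_eq\<close>)
  finally show ?thesis .
qed

theorem theorem15:
  fixes P :: "'d measure"
    and A :: "'d \<Rightarrow> real^'n^'n"
    and B :: "'d \<Rightarrow> real^'m^'n"
    and w :: "'d \<Rightarrow> real^'n"
    and x0 :: "real^'n"
    and U :: "(real^'m) set"
    and X :: "(real^'n) set"
    and l :: "real^'n \<Rightarrow> real^'m \<Rightarrow> real"
    and sel :: "real^'n \<Rightarrow> (nat \<times> nat \<Rightarrow> 'd) \<Rightarrow> nat set"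
    and sol :: "real^'n \<Rightarrow> (nat \<times> nat \<Rightarrow> 'd) \<Rightarrow> nat \<Rightarrow> real^'m"
    and \<epsilon> :: real
    and N K R T :: nat
  assumes "prob_space P"
    and "A \<in> borel_measurable P" and "B \<in> borel_measurable P" and "w \<in> borel_measurable P"
    and "X \<in> sets borel"
    and "1 \<le> N"
    and "bounded U" and "convex U" and "convex X"
    and "\<And>x u. 0 \<le> l x u" and "convex_on UNIV (\<lambda>(x, u). l x u)"
    and "R \<le> K"
    and "\<And>x om. om \<in> space (scenario_law P N K) \<Longrightarrow> sel x om \<subseteq> {1..K} \<and> card (sel x om) = K - R"
    and "\<And>i. i < N \<Longrightarrow>
           (\<lambda>(x, om). sol x om i) \<in> borel_measurable (borel \<Otimes>\<^sub>M scenario_law P N K)"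
    and "\<And>x om. om \<in> space (scenario_law P N K) \<Longrightarrow>
           fhscp_feasible A B w U X N sel x om \<noteq> {} \<Longrightarrow>
           sol x om \<in> fhscp_solutions A B w l U X N K sel x om"
    and "\<And>t. AE F in history_law P N K (Suc t).
           fhscp_feasible A B w U X N sel (closed_loop A B w sol x0 F t) (snd (F t)) \<noteq> {}"
    and "0 < \<epsilon>" and "\<epsilon> < 1/2"
    and "admissible_pair P A B w U X N sel sol \<epsilon> K R"
    and "1 \<le> T"
  shows "(LINT F|history_law P N K T.
            (1 / real T) * (\<Sum>t<T. indicat_real (- X) (closed_loop A B w sol x0 F (Suc t)))) \<le> \<epsilon>"
proof -
  let ?x = "closed_loop A B w sol x0"
  let ?H = "history_law P N K"
  let ?I = "\<lambda>t F. indicat_real (- X) (?x F (Suc t))"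
  note AB = assms(2-4)
  have sol0: "(\<lambda>(x, om). sol x om 0) \<in> borel_measurable (borel \<Otimes>\<^sub>M scenario_law P N K)"
    using assms(6) by (intro assms(14)) simp
  interpret H: prob_space "?H T" using assms(1) by (rule prob_space_history_law)
  have meas: "?I t \<in> borel_measurable (?H S)" if "t < S" for t S
    using measurable_compose[OF measurable_closed_loop[where sol = sol and t = "Suc t" and T = S and ?x0.0 = x0, OF AB sol0], of "indicat_real (- X)" borel]
      that \<open>X \<in> sets borel\<close> by simp
  have int: "integrable (?H T) (?I t)" if "t < T" for t
    using meas[OF that] by (intro H.integrable_const_bound[where B = 1]) (auto simp del: closed_loop.simps)
  \<comment> \<open>The term at time \<open>t\<close> reads only the first \<open>t + 1\<close>
    coordinates, so its expectation is the same on horizon \<open>t + 1\<close>, where the one-step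
    bound applies.\<close>
  have bound: "(LINT F|?H T. ?I t F) \<le> \<epsilon>" if "t < T" for t
  proof -
    have "restrict F {..<Suc t} s = F s" if "s < Suc t" for F :: "nat \<Rightarrow> 'd \<times> (nat \<times> nat \<Rightarrow> 'd)" and s
      using that by simp
    then have "?x (restrict F {..<Suc t}) (Suc t) = ?x F (Suc t)" for F
      by (rule closed_loop_cong)
    then have "(LINT F|?H T. ?I t F) = (LINT F|?H T. ?I t (restrict F {..<Suc t}))"
      by (simp only:)
    also have "\<dots> = (LINT F|distr (?H T) (?H (Suc t)) (\<lambda>F. restrict F {..<Suc t}). ?I t F)"
      using that unfolding history_law_def
      by (intro integral_distr[symmetric] measurable_restrict_subset meas[unfolded history_law_def]) auto
    also have "\<dots> = (LINT F|?H (Suc t). ?I t F)"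
      using history_law_restrict[OF assms(1), of "Suc t" T] that by simp
    also have "\<dots> \<le> \<epsilon>"
      using assms by (intro expected_violation_le sol0) auto
    finally show ?thesis .
  qed
  have "(LINT F|?H T. (1 / real T) * (\<Sum>t<T. ?I t F)) = (1 / real T) * (\<Sum>t<T. LINT F|?H T. ?I t F)"
    using int by (simp add: Bochner_Integration.integral_sum del: closed_loop.simps)
  also have "\<dots> \<le> (1 / real T) * (\<Sum>t<T. \<epsilon>)"
    by (intro mult_left_mono sum_mono bound) auto
  \<comment> \<open>The factor \<open>1 / real T\<close> cancels the \<open>T\<close> equal summands
    because \<open>T\<close> is nonzero.\<close>
  also have "\<dots> = \<epsilon>" using \<open>1 \<le> T\<close> by simp
  finally show ?thesis .
qed

end
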